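(* Let $A_0\subseteq\{2,\ldots,n\}$, let $A_1,\ldots,A_t$ be distinct sets satisfying $A_i\subseteq A_0$ and $|A_0\setminus A_i|=1$ for $i=1,\ldots,t$, and let $c_0,c_1,\ldots,c_t\ge 0$ be non-negative real numbers. Then the following inequality of operators holds in $\mathbb{R}[\mathrm{Sym}_n]$: $$\Big(\sum_{i=0}^{t}c_i|A_i|\Big)\Big(\sum_{j=0}^{t}c_j\big(\alpha_{A_j\cup\{1\}}-\alpha_{A_j}\big)\Big)\ \ge\ \sum_{i=0}^{t}c_i^{2}\,\alpha_{A_i}+\sum_{0\le i<j\le t}c_ic_j\big(\alpha_{A_0}+\alpha_{A_i\cap A_j}\big).$$
   Context: $\mathrm{Sym}_n$ is the symmetric group on $[n]=\{1,\ldots,n\}$. For $\emptyset\ne A\subseteq[n]$, $$\alpha_A=\frac{1}{(|A|-1)!}\sum_{\pi\in\mathrm{Sym}(A)}(\mathrm{id}-\pi)\in\mathbb{R}[\mathrm{Sym}_n],$$ where $\mathrm{Sym}(A)\subseteq\mathrm{Sym}_n$ is the subgroup of permutations fixing every element outside $A$; and $\alpha_\emptyset=0$. For $\Sigma_1,\Sigma_2\in\mathbb{R}[\mathrm{Sym}_n]$, the inequality of operators $\Sigma_1\ge\Sigma_2$ means that $\Sigma_1-\Sigma_2$ acts as a positive semi-definite (self-adjoint with non-negative eigenvalues) operator in every finite-dimensional representation of $\mathrm{Sym}_n$ (with respect to a $\mathrm{Sym}_n$-invariant inner product); equivalently, it acts as a positive semi-definite operator by left multiplication on the regular representation $\mathbb{R}[\mathrm{Sym}_n]$,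 equipped with the inner product for which the group elements are orthonormal. *)

theory Defs
  imports "HOL-Combinatorics.Permutations" "Jordan_Normal_Form.Char_Poly"
begin

definition Sym :: "nat \<Rightarrow> (nat \<Rightarrow> nat) set" where
  "Sym n = {\<pi>. \<pi> permutes {1..n}}"

text \<open>An element of the group algebra of \<open>Sym n\<close> over the reals is given by its coefficient
  function \<open>\<Sigma>\<close>, standing for the sum of \<open>\<Sigma> \<pi> \<cdot> \<pi>\<close> over \<open>\<pi> \<in> Sym n\<close>; values outside \<open>Sym n\<close>
  are never used. The vector space operations are pointwise.\<close>

type_synonym group_alg = "(nat \<Rightarrow> nat) \<Rightarrow> real"

definition group_elem :: "(nat \<Rightarrow> nat) \<Rightarrow> group_alg" where
  "group_elem \<pi> = (\<lambda>\<sigma>. if \<sigma> = \<pi> then 1 else 0)"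

text \<open>Since \<open>\<pi> permutes A\<close> includes that \<open>\<pi>\<close> fixes all points outside \<open>A\<close>, for
  \<open>A \<subseteq> {1..n}\<close> the same function represents \<open>\<alpha>\<^sub>A\<close> for every such \<open>n\<close>.\<close>

definition \<alpha> :: "nat set \<Rightarrow> group_alg" where
  "\<alpha> A = (\<lambda>\<sigma>. if A = {} then 0
     else 1 / fact (card A - 1) *
       (\<Sum>\<pi> | \<pi> permutes A. group_elem id \<sigma> - group_elem \<pi> \<sigma>))"

text \<open>Finite-dimensional complex representations, in coordinates with respect to a basis.
  Real representations are covered via complexification.\<close>

definition sym_rep :: "nat \<Rightarrow> nat \<Rightarrow> ((nat \<Rightarrow> nat) \<Rightarrow> complex mat) \<Rightarrow> bool" where
  "sym_rep n d \<rho> \<longleftrightarrow>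
     (\<forall>g\<in>Sym n. \<rho> g \<in> carrier_mat d d) \<and> \<rho> id = 1\<^sub>m d \<and>
     (\<forall>g\<in>Sym n. \<forall>h\<in>Sym n. \<rho> (g \<circ> h) = \<rho> g * \<rho> h)"

definition inner_product :: "nat \<Rightarrow> (complex vec \<Rightarrow> complex vec \<Rightarrow> complex) \<Rightarrow> bool" where
  "inner_product d ip \<longleftrightarrow>
     (\<forall>u\<in>carrier_vec d. \<forall>v\<in>carrier_vec d. \<forall>w\<in>carrier_vec d. ip (u + v) w = ip u w + ip v w) \<and>
     (\<forall>a. \<forall>v\<in>carrier_vec d. \<forall>w\<in>carrier_vec d. ip (a \<cdot>\<^sub>v v) w = a * ip v w) \<and>
     (\<forall>v\<in>carrier_vec d. \<forall>w\<in>carrier_vec d. ip w v = cnj (ip v w)) \<and>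
     (\<forall>v\<in>carrier_vec d. v \<noteq> 0\<^sub>v d \<longrightarrow> Re (ip v v) > 0)"

definition invariant_ip ::
  "nat \<Rightarrow> nat \<Rightarrow> ((nat \<Rightarrow> nat) \<Rightarrow> complex mat) \<Rightarrow> (complex vec \<Rightarrow> complex vec \<Rightarrow> complex) \<Rightarrow> bool" where
  "invariant_ip n d \<rho> ip \<longleftrightarrow>
     (\<forall>g\<in>Sym n. \<forall>v\<in>carrier_vec d. \<forall>w\<in>carrier_vec d. ip (\<rho> g *\<^sub>v v) (\<rho> g *\<^sub>v w) = ip v w)"

definition act :: "nat \<Rightarrow> nat \<Rightarrow> ((nat \<Rightarrow> nat) \<Rightarrow> complex mat) \<Rightarrow> group_alg \<Rightarrow> complex mat" where
  "act n d \<rho> \<Sigma> = mat d d (\<lambda>(i, j). \<Sum>g\<in>Sym n. complex_of_real (\<Sigma> g) * \<rho> g $$ (i, j))"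

definition pos_semidef ::
  "nat \<Rightarrow> (complex vec \<Rightarrow> complex vec \<Rightarrow> complex) \<Rightarrow> complex mat \<Rightarrow> bool" where
  "pos_semidef d ip M \<longleftrightarrow>
     (\<forall>v\<in>carrier_vec d. \<forall>w\<in>carrier_vec d. ip (M *\<^sub>v v) w = ip v (M *\<^sub>v w)) \<and>
     (\<forall>k. eigenvalue M k \<longrightarrow> k \<in> \<real> \<and> Re k \<ge> 0)"

definition op_ge :: "group_alg \<Rightarrow> nat \<Rightarrow> group_alg \<Rightarrow> bool" ("_ \<succeq>\<^bsub>_\<^esub> _" [51, 0, 51] 50) where
  "\<Sigma>\<^sub>1 \<succeq>\<^bsub>n\<^esub> \<Sigma>\<^sub>2 \<longleftrightarrow>
     (\<forall>d \<rho> ip. sym_rep n d \<rho> \<and> inner_product d ip \<and> invariant_ip n d \<rho> ip \<longrightarrow>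
        pos_semidef d ip (act n d \<rho> (\<lambda>\<sigma>. \<Sigma>\<^sub>1 \<sigma> - \<Sigma>\<^sub>2 \<sigma>)))"

end

theory Submission
  imports Defs
begin

text \<open>
  Write \<open>X = A\<^sub>0 \<union> {1}\<close>, let \<open>P\<^sub>B\<close> be the average of all permutations of \<open>B\<close>, which is the
  projection onto the \<open>Sym(B)\<close>-invariants, and let \<open>O\<close> be the left-hand side minus the right-hand
  side. Since \<open>\<alpha>\<^sub>B = |B| (id - P\<^sub>B)\<close> and \<open>|A\<^sub>i| + |A\<^sub>j| = |A\<^sub>0| + |A\<^sub>i \<inter> A\<^sub>j|\<close> for \<open>i < j\<close>, the
  multiples of the identity cancel in \<open>O\<close>. What remains is a combination of averages in which only
  the \<open>P\<^sub>B\<close> with \<open>B = A\<^sub>j \<union> {1}\<close> have negative coefficients. These sets are \<open>X\<close> itself and sets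
  \<open>X - {x}\<close>, so that \<open>O\<close> can only be negative on the part of a representation that is generated by
  the vectors fixed by a point stabilizer of \<open>Sym(X)\<close>. That part consists of copies of
  constituents of the permutation representation \<open>\<real>\<^sup>X\<close>, hence only \<open>\<real>\<^sup>X\<close> has to be understood.

  On \<open>\<real>\<^sup>X\<close> the element \<open>\<alpha>\<^sub>B\<close> is the Laplacian of the complete graph on \<open>B\<close>, and a computation with
  one pair \<open>i < j\<close> at a time shows that \<open>O\<close> acts as the rank one matrix \<open>y y\<^sup>T\<close> with
  \<open>y = \<Sum>\<^sub>i c\<^sub>i (1\<^bsub>A\<^sub>i\<^esub> - |A\<^sub>i| e\<^sub>1)\<close>, which is positive semi-definite.

  The passage to \<open>\<real>\<^sup>X\<close> is made for eigenvectors and with scalars only. Let \<open>O v = k v\<close>, where \<open>k\<close> is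
  real because \<open>O\<close> is self-adjoint, and let \<open>F g = Re \<langle>g v, v\<rangle>\<close>. For \<open>z \<in> X\<close> the sums \<open>u\<^sub>z x\<close> of
  \<open>F h\<close> over the coset of all \<open>h \<in> Sym(X)\<close> with \<open>h x = z\<close> form a vector in \<open>\<real>\<^sup>X\<close> satisfying
  \<open>k u\<^sub>z = O u\<^sub>z\<close>, that is \<open>k u\<^sub>z x = y x (\<Sum>\<^sub>w y w u\<^sub>z w)\<close>. If \<open>k < 0\<close>, then \<open>u\<^sub>z = 0\<close> for every
  \<open>z\<close>, and therefore the sums of \<open>F\<close> over \<open>Sym(X)\<close> and over all \<open>Sym(X - {x})\<close> vanish. In
  \<open>k \<langle>v, v\<rangle> = Re \<langle>O v, v\<rangle>\<close> only the averages with non-negative coefficients are left, and \<open>k \<ge> 0\<close>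
  after all. The computation in \<open>\<real>\<^sup>X\<close> is \<open>octopus_form_rank_one\<close>, the last step is
  \<open>octopus_form_nonneg\<close>, and \<open>eigenvalue_nonneg\<close> combines them.
\<close>

\<comment> \<open>From here on \<open>inv\<close> is the inverse of a function, not that of an element of an algebraic group.\<close>
unbundle no m_inv_syntax

section \<open>The difference of the two sides as a linear form\<close>

text \<open>The difference of the two sides is linear in the family of all \<open>\<alpha>\<^sub>B\<close>. Having a number \<open>a B\<close>
  in the place of \<open>\<alpha>\<^sub>B\<close> allows for its values at a permutation and for the values of linear
  functionals on it alike.\<close>

definition octopus_form :: "nat \<Rightarrow> (nat \<Rightarrow> real) \<Rightarrow> (nat \<Rightarrow> nat set) \<Rightarrow> (nat set \<Rightarrow> real) \<Rightarrow> real" where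
  "octopus_form t c A a =
     (\<Sum>i=0..t. c i * real (card (A i))) * (\<Sum>j=0..t. c j * (a (A j \<union> {1}) - a (A j)))
     - ((\<Sum>i=0..t. (c i)\<^sup>2 * a (A i))
        + (\<Sum>(i, j) | i < j \<and> j \<le> t. c i * c j * (a (A 0) + a (A i \<inter> A j))))"

lemma finite_pairs: "finite {(i, j). i < j \<and> j \<le> (t::nat)}"
  by (rule finite_subset[of _ "{0..t} \<times> {0..t}"]) auto

lemma sum_mult_sum_pairs:
  fixes p q :: "nat \<Rightarrow> real"
  shows "(\<Sum>i=0..t. p i) * (\<Sum>j=0..t. q j)
    = (\<Sum>i=0..t. p i * q i) + (\<Sum>(i, j) | i < j \<and> j \<le> t. p i * q j + p j * q i)"
proof (induction t)
  case 0
  have "{(i, j). i < j \<and> j \<le> (0::nat)} = {}" by auto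
  then show ?case by (simp only: sum.empty) simp
next
  case (Suc t)
  have split: "{(i, j). i < j \<and> j \<le> Suc t}
      = {(i, j). i < j \<and> j \<le> t} \<union> (\<lambda>i. (i, Suc t)) ` {0..t}"
    by (auto simp: image_iff)
  have "(\<Sum>(i, j) | i < j \<and> j \<le> Suc t. p i * q j + p j * q i)
      = (\<Sum>(i, j) | i < j \<and> j \<le> t. p i * q j + p j * q i)
        + (\<Sum>i=0..t. p i * q (Suc t) + p (Suc t) * q i)"
    unfolding split
    by (subst sum.union_disjoint) (auto simp: finite_pairs sum.reindex inj_on_def)
  moreover have "(\<Sum>i=0..t. p i * q (Suc t) + p (Suc t) * q i)
      = (\<Sum>i=0..t. p i) * q (Suc t) + p (Suc t) * (\<Sum>i=0..t. q i)"
    by (simp add: sum.distrib sum_distrib_left sum_distrib_right)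
  moreover have "(\<Sum>i=0..Suc t. p i) * (\<Sum>j=0..Suc t. q j)
      = (\<Sum>i=0..t. p i) * (\<Sum>j=0..t. q j) + (\<Sum>i=0..t. p i) * q (Suc t)
        + p (Suc t) * (\<Sum>i=0..t. q i) + p (Suc t) * q (Suc t)"
    by (simp add: algebra_simps)
  ultimately show ?case using Suc.IH by simp
qed

text \<open>Both evaluations of the linear form below compare it with a product of two sums; after this
  rearrangement they reduce to one identity for each index and one for each pair.\<close>

lemma sum_mult_sum_minus_pairs:
  fixes p q d :: "nat \<Rightarrow> real"
  shows "(\<Sum>i=0..t. p i) * (\<Sum>j=0..t. q j) - ((\<Sum>i=0..t. d i) + (\<Sum>(i, j) | i < j \<and> j \<le> t. e i j))
    = (\<Sum>i=0..t. p i * q i - d i) + (\<Sum>(i, j) | i < j \<and> j \<le> t. p i * q j + p j * q i - e i j)"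
  unfolding sum_mult_sum_pairs case_prod_unfold sum_subtractf by linarith

lemma octopus_form_sum:
  "(\<Sum>g\<in>S. octopus_form t c A (\<lambda>B. a B g) * F g) = octopus_form t c A (\<lambda>B. \<Sum>g\<in>S. a B g * F g)"
proof -
  have 1: "(\<Sum>g\<in>S. (\<Sum>j=0..t. c j * (a (A j \<union> {1}) g - a (A j) g)) * F g)
    = (\<Sum>j=0..t. c j * ((\<Sum>g\<in>S. a (A j \<union> {1}) g * F g) - (\<Sum>g\<in>S. a (A j) g * F g)))"
    by (subst sum_distrib_right, subst sum.swap)
       (simp add: sum_subtractf sum_distrib_left algebra_simps)
  have 2: "(\<Sum>g\<in>S. (\<Sum>i=0..t. (c i)\<^sup>2 * a (A i) g) * F g)
    = (\<Sum>i=0..t. (c i)\<^sup>2 * (\<Sum>g\<in>S. a (A i) g * F g))"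
    by (subst sum_distrib_right, subst sum.swap) (simp add: sum_distrib_left mult.assoc)
  have 3: "(\<Sum>g\<in>S. (\<Sum>(i, j) | i < j \<and> j \<le> t. c i * c j * (a (A 0) g + a (A i \<inter> A j) g)) * F g)
    = (\<Sum>(i, j) | i < j \<and> j \<le> t.
        c i * c j * ((\<Sum>g\<in>S. a (A 0) g * F g) + (\<Sum>g\<in>S. a (A i \<inter> A j) g * F g)))"
    unfolding sum_distrib_right
    by (subst sum.swap, intro sum.cong refl)
       (simp add: case_prod_unfold sum.distrib[symmetric] sum_distrib_left algebra_simps)
  have "(\<Sum>g\<in>S. (C * X g - (Y g + Z g)) * F g)
      = C * (\<Sum>g\<in>S. X g * F g) - ((\<Sum>g\<in>S. Y g * F g) + (\<Sum>g\<in>S. Z g * F g))"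
    for C :: real and X Y Z
    by (simp add: algebra_simps sum.distrib sum_subtractf sum_distrib_left)
  then show ?thesis
    unfolding octopus_form_def 1[symmetric] 2[symmetric] 3[symmetric] .
qed

section \<open>Averages over symmetric groups\<close>

text \<open>\<open>Sym(B)\<close> is transitive on \<open>B\<close>, so the sum on the left is the same for all \<open>x \<in> B\<close>; summing
  it over \<open>x\<close> gives \<open>sum u B\<close> for each permutation.\<close>

lemma sum_permutes_orbit:
  fixes u :: "'a \<Rightarrow> real"
  assumes B: "finite B" and x: "x \<in> B"
  shows "real (card B) * (\<Sum>\<pi> | \<pi> permutes B. u (inv \<pi> x)) = fact (card B) * sum u B"
proof -
  let ?G = "{\<pi>. \<pi> permutes B}"
  have same: "(\<Sum>\<pi>\<in>?G. u (inv \<pi> y)) = (\<Sum>\<pi>\<in>?G. u (inv \<pi> x))" if y: "y \<in> B" for y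
  proof -
    let ?s = "Transposition.transpose x y"
    have s: "?s permutes B" using x y by (rule permutes_swap_id)
    have "(\<Sum>\<pi>\<in>?G. u (inv \<pi> y)) = (\<Sum>\<pi>\<in>?G. u (inv (?s \<circ> \<pi>) y))"
      by (rule setum_permutations_compose_left[OF s])
    also have "\<dots> = (\<Sum>\<pi>\<in>?G. u (inv \<pi> x))"
    proof (intro sum.cong refl)
      fix \<pi> assume "\<pi> \<in> ?G"
      then have "inv (?s \<circ> \<pi>) = inv \<pi> \<circ> inv ?s"
        by (intro o_inv_distrib) (auto simp: permutes_bij)
      then show "u (inv (?s \<circ> \<pi>) y) = u (inv \<pi> x)" by simp
    qed
    finally show ?thesis .
  qed
  have "real (card B) * (\<Sum>\<pi>\<in>?G. u (inv \<pi> x)) = (\<Sum>y\<in>B. \<Sum>\<pi>\<in>?G. u (inv \<pi> y))"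
    using same by simp
  also have "\<dots> = (\<Sum>\<pi>\<in>?G. \<Sum>y\<in>B. u (inv \<pi> y))" by (rule sum.swap)
  also have "\<dots> = (\<Sum>\<pi>\<in>?G. sum u B)"
  proof (rule sum.cong[OF refl])
    fix \<pi> assume "\<pi> \<in> ?G"
    then have "inv \<pi> permutes B" by (simp add: permutes_inv)
    then show "(\<Sum>y\<in>B. u (inv \<pi> y)) = sum u B" using sum.permute[of "inv \<pi>" B u] by (simp add: o_def)
  qed
  also have "\<dots> = fact (card B) * sum u B"
    by (simp add: card_permutations[OF refl B])
  finally show ?thesis .
qed

text \<open>This is \<open>\<alpha>\<^sub>B = |B| (id - P\<^sub>B)\<close>, paired with an arbitrary function \<open>F\<close>. In this form it
  holds for \<open>B = {}\<close> as well.\<close>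

lemma sum_alpha:
  assumes B: "B \<subseteq> {1..n}"
  shows "(\<Sum>g\<in>Sym n. \<alpha> B g * F g)
    = real (card B) * (F id - (\<Sum>\<pi> | \<pi> permutes B. F \<pi>) / fact (card B))"
proof (cases "B = {}")
  case True
  then show ?thesis by (simp add: \<alpha>_def)
next
  case False
  let ?G = "{\<pi>. \<pi> permutes B}"
  have finB: "finite B" using B finite_subset by blast
  have finS: "finite (Sym n)" unfolding Sym_def by (rule finite_permutations) simp
  have delta: "(\<Sum>g\<in>Sym n. group_elem \<pi> g * F g) = F \<pi>" if "\<pi> \<in> Sym n" for \<pi>
  proof -
    have "(\<Sum>g\<in>Sym n. group_elem \<pi> g * F g) = (\<Sum>g\<in>Sym n. if \<pi> = g then F g else 0)"
      by (intro sum.cong) (auto simp: group_elem_def)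
    then show ?thesis using that finS by simp
  qed
  have G: "\<pi> \<in> Sym n" if "\<pi> \<in> ?G" for \<pi>
    using permutes_subset[OF _ B] that by (simp add: Sym_def)
  have id: "id \<in> Sym n" by (simp add: Sym_def permutes_id)
  have "(\<Sum>g\<in>Sym n. \<alpha> B g * F g)
      = (\<Sum>g\<in>Sym n. \<Sum>\<pi>\<in>?G. 1 / fact (card B - 1) * (group_elem id g * F g - group_elem \<pi> g * F g))"
    using False by (simp add: \<alpha>_def sum_distrib_left sum_distrib_right left_diff_distrib mult.assoc)
  also have "\<dots> = 1 / fact (card B - 1) * (\<Sum>\<pi>\<in>?G. F id - F \<pi>)"
    by (subst sum.swap) (simp add: sum_divide_distrib[symmetric] sum_subtractf delta id G)
  also have "(\<Sum>\<pi>\<in>?G. F id - F \<pi>) = fact (card B) * F id - (\<Sum>\<pi>\<in>?G. F \<pi>)"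
    by (simp add: sum_subtractf card_permutations[OF refl finB])
  also have "1 / fact (card B - 1) * (fact (card B) * F id - (\<Sum>\<pi>\<in>?G. F \<pi>))
      = real (card B) * (F id - (\<Sum>\<pi>\<in>?G. F \<pi>) / fact (card B))"
  proof -
    have "card B > 0" using False finB by (simp add: card_gt_0_iff)
    then have "(fact (card B) :: real) = real (card B) * fact (card B - 1)" by (rule fact_reduce)
    then show ?thesis using \<open>card B > 0\<close> by (simp add: field_simps)
  qed
  finally show ?thesis .
qed

lemma alpha_inv:
  assumes "bij \<sigma>"
  shows "\<alpha> B (inv \<sigma>) = \<alpha> B \<sigma>"
proof -
  have ge: "group_elem (inv \<pi>) (inv \<sigma>) = group_elem \<pi> \<sigma>" if "bij \<pi>" for \<pi>
    using inv_inv_eq[OF that] inv_inv_eq[OF assms] unfolding group_elem_def by metis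
  have "(\<Sum>\<pi> | \<pi> permutes B. group_elem id (inv \<sigma>) - group_elem \<pi> (inv \<sigma>))
    = (\<Sum>\<pi> | \<pi> permutes B. group_elem id (inv \<sigma>) - group_elem (inv \<pi>) (inv \<sigma>))"
    by (rule sum_permutations_inverse)
  also have "\<dots> = (\<Sum>\<pi> | \<pi> permutes B. group_elem id \<sigma> - group_elem \<pi> \<sigma>)"
    using ge ge[OF bij_id] by (intro sum.cong refl) (auto simp: permutes_bij)
  finally show ?thesis by (simp add: \<alpha>_def)
qed

section \<open>A set and its subsets of codimension one\<close>

locale octopus =
  fixes t :: nat and A :: "nat \<Rightarrow> nat set" and c :: "nat \<Rightarrow> real"
  assumes finA0: "finite (A 0)" and one_notin: "1 \<notin> A 0"
    and injA: "inj_on A {1..t}"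
    and A_sub: "\<And>i. i \<in> {1..t} \<Longrightarrow> A i \<subseteq> A 0 \<and> card (A 0 - A i) = 1"
    and c_nonneg: "\<And>i. i \<in> {0..t} \<Longrightarrow> c i \<ge> 0"
begin

lemma A_le: "i \<le> t \<Longrightarrow> A i \<subseteq> A 0"
  using A_sub[of i] by (cases i) auto

lemma A_finite: "i \<le> t \<Longrightarrow> finite (A i)"
  using A_le finA0 finite_subset by blast

lemma A_remove:
  assumes "i \<in> {1..t}"
  obtains a where "a \<in> A 0" "A i = A 0 - {a}"
proof -
  obtain a where "A 0 - A i = {a}"
    using A_sub[OF assms] card_1_singletonE by blast
  with A_sub[OF assms] that[of a] show ?thesis by blast
qed

lemma pair_cases:
  assumes "i < j" "j \<le> t"
  obtains b where "i = 0" "b \<in> A 0" "A j = A 0 - {b}"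
  | a b where "a \<in> A 0" "b \<in> A 0" "a \<noteq> b" "A i = A 0 - {a}" "A j = A 0 - {b}"
proof -
  have "j \<in> {1..t}" using assms by auto
  then obtain b where b: "b \<in> A 0" "A j = A 0 - {b}" by (rule A_remove)
  show ?thesis
  proof (cases "i = 0")
    case True
    then show ?thesis using b by (rule that(1))
  next
    case False
    then have i: "i \<in> {1..t}" using assms by auto
    then obtain a where a: "a \<in> A 0" "A i = A 0 - {a}" by (rule A_remove)
    have "A i \<noteq> A j"
      using inj_onD[OF injA _ i \<open>j \<in> {1..t}\<close>] assms(1) by blast
    then have "a \<noteq> b" using a(2) b(2) by metis
    with a(1) b(1) show ?thesis using a(2) b(2) by (rule that(2))
  qed
qed

text \<open>The coefficient of \<open>c\<^sub>i c\<^sub>j\<close> at a point \<open>x \<in> A\<^sub>0\<close> in the rank one formula below. It says that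
  at \<open>x\<close> the linear form factors pairwise: with \<open>\<chi>\<^sub>i\<close> the indicator of \<open>A\<^sub>i\<close> and \<open>l\<^sub>i\<close> the sum of
  \<open>u\<close> over \<open>A\<^sub>i\<close>, the right-hand side is the mixed part of the product
  \<open>(\<Sum>\<^sub>i c\<^sub>i \<chi>\<^sub>i) (\<Sum>\<^sub>j c\<^sub>j l\<^sub>j)\<close>.\<close>

lemma pair_identity:
  fixes u :: "nat \<Rightarrow> real"
  assumes ij: "i < j" "j \<le> t" and x: "x \<in> A 0"
  shows "real (card (A i)) * (of_bool (x \<in> A j) * u x)
       + real (card (A j)) * (of_bool (x \<in> A i) * u x)
       - ((real (card (A 0)) * u x - sum u (A 0))
          + (if x \<in> A i \<inter> A j then real (card (A i \<inter> A j)) * u x - sum u (A i \<inter> A j) else 0))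
     = of_bool (x \<in> A i) * sum u (A j) + of_bool (x \<in> A j) * sum u (A i)"
  using ij
proof (cases rule: pair_cases)
  case (1 b)
  have I: "A i \<inter> A j = A 0 - {b}" using A_le[OF ij(2)] 1(1,3) by blast
  obtain N where N: "real (card (A 0 - {b})) = N" by blast
  have n: "real (card (A 0)) = 1 + N"
    unfolding card.remove[OF finA0 1(2)] of_nat_Suc N ..
  obtain S where S: "sum u (A 0 - {b}) = S" by blast
  have s: "sum u (A 0) = u b + S"
    unfolding sum.remove[OF finA0 1(2), of u] S ..
  have x': "x \<in> A 0 - {b} \<longleftrightarrow> x \<noteq> b" using x by blast
  show ?thesis
    unfolding I unfolding 1(1,3) n s N S x' using x by (cases "x = b") (simp_all add: algebra_simps)
next
  case (2 a b)
  have I: "A i \<inter> A j = A 0 - {a, b}" using 2(4,5) by blast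
  have D: "A 0 - {a} - {b} = A 0 - {a, b}" "A 0 - {b} - {a} = A 0 - {a, b}" by auto
  have a: "a \<in> A 0 - {b}" and b: "b \<in> A 0 - {a}" using 2(1-3) by auto
  obtain N where N: "real (card (A 0 - {a, b})) = N" by blast
  have n: "real (card (A 0 - {a})) = 1 + N" "real (card (A 0 - {b})) = 1 + N"
    unfolding card.remove[OF finite_Diff[OF finA0] a] card.remove[OF finite_Diff[OF finA0] b]
      of_nat_Suc D N by (rule refl)+
  have n0: "real (card (A 0)) = 1 + (1 + N)"
    unfolding card.remove[OF finA0 2(1)] of_nat_Suc n ..
  obtain S where S: "sum u (A 0 - {a, b}) = S" by blast
  have s: "sum u (A 0 - {a}) = u b + S" "sum u (A 0 - {b}) = u a + S"
    unfolding sum.remove[OF finite_Diff[OF finA0] a] sum.remove[OF finite_Diff[OF finA0] b]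
      D S by (rule refl)+
  have s0: "sum u (A 0) = u a + (u b + S)"
    unfolding sum.remove[OF finA0 2(1), of u] s ..
  have x': "x \<in> A 0 - {a} \<longleftrightarrow> x \<noteq> a" "x \<in> A 0 - {b} \<longleftrightarrow> x \<noteq> b"
    "x \<in> A 0 - {a, b} \<longleftrightarrow> x \<noteq> a \<and> x \<noteq> b"
    using x by blast+
  consider "x = a" | "x = b" | "x \<noteq> a" "x \<noteq> b" by blast
  then show ?thesis
    unfolding I unfolding 2(4,5) n n0 s s0 N S x'
    using 2(3) by cases (simp_all add: algebra_simps)
qed

lemma pair_card:
  assumes "i < j" "j \<le> t"
  shows "real (card (A i)) + real (card (A j)) = real (card (A 0)) + real (card (A i \<inter> A j))"
  using assms
proof (cases rule: pair_cases)
  case (1 b)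
  have "A i \<inter> A j = A j" using A_le[OF assms(2)] 1 by blast
  then show ?thesis unfolding \<open>i = 0\<close> by (simp only:)
next
  case (2 a b)
  have U: "A i \<union> A j = A 0" using 2 by auto
  have "card (A i) + card (A j) = card (A 0) + card (A i \<inter> A j)"
    using card_Un_Int[of "A i" "A j"] A_finite assms unfolding U by simp
  then show ?thesis unfolding of_nat_add[symmetric] by (simp only:)
qed

section \<open>The action on the permutation representation\<close>

text \<open>The value of \<open>\<alpha>\<^sub>B\<close> applied to \<open>u \<in> \<real>\<^sup>X\<close> at the point \<open>x\<close> is the expression after \<open>\<lambda>B\<close>. The
  two factors on the right are the entry \<open>y x\<close> and the inner product of \<open>y\<close> with \<open>u\<close>, where
  \<open>y = \<Sum>\<^sub>i c\<^sub>i (1\<^bsub>A\<^sub>i\<^esub> - |A\<^sub>i| e\<^sub>1)\<close>. Thus the difference of the two sides acts as \<open>y y\<^sup>T\<close>.\<close>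

lemma octopus_form_rank_one:
  fixes u :: "nat \<Rightarrow> real"
  assumes x: "x \<in> A 0 \<union> {1}"
  shows "octopus_form t c A (\<lambda>B. if x \<in> B then real (card B) * u x - sum u B else 0)
    = (if x = 1 then - (\<Sum>i=0..t. c i * real (card (A i))) else (\<Sum>i=0..t. c i * of_bool (x \<in> A i)))
      * (\<Sum>i=0..t. c i * (sum u (A i) - real (card (A i)) * u 1))"
    (is "octopus_form t c A ?a = _")
proof -
  have notin: "1 \<notin> A i" if "i \<le> t" for i
    using A_le[OF that] one_notin by auto
  have new: "real (card (A i \<union> {1})) = real (card (A i)) + 1"
    "sum u (A i \<union> {1}) = sum u (A i) + u 1" if "i \<le> t" for i
    using notin[OF that] A_finite[OF that] by auto
  show ?thesis
  proof (cases "x = 1")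
    case True
    have "?a (A i) = 0" "?a (A i \<inter> A j) = 0" if "i \<le> t" for i j
      using notin[OF that] True by auto
    then have "octopus_form t c A ?a
      = (\<Sum>i=0..t. c i * real (card (A i))) * (\<Sum>j=0..t. c j * ?a (A j \<union> {1}))"
      unfolding octopus_form_def by (simp add: case_prod_unfold)
    also have "(\<Sum>j=0..t. c j * ?a (A j \<union> {1}))
      = - (\<Sum>i=0..t. c i * (sum u (A i) - real (card (A i)) * u 1))"
      unfolding sum_negf[symmetric]
      by (intro sum.cong refl) (use True new in \<open>auto simp: algebra_simps\<close>)
    finally show ?thesis using True by simp
  next
    case False
    then have x0: "x \<in> A 0" using x by simp
    \<comment> \<open>The terms with \<open>u 1\<close> come only from the sets \<open>A j \<union> {1}\<close>; without them the claim is the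
      product expansion, term by term.\<close>
    define n where "n i = real (card (A i))" for i
    define e where "e i = (of_bool (x \<in> A i) :: real)" for i
    define l where "l i = sum u (A i)" for i
    have leg: "(\<Sum>j=0..t. c j * (?a (A j \<union> {1}) - ?a (A j)))
      = (\<Sum>j=0..t. c j * e j) * (u x - u 1)"
      unfolding sum_distrib_right e_def
      by (intro sum.cong refl) (use False new in \<open>auto simp: algebra_simps\<close>)
    have diag: "c i * n i * (c i * e i * u x) - (c i)\<^sup>2 * ?a (A i) = c i * e i * (c i * l i)" for i
      by (simp add: n_def e_def l_def power2_eq_square algebra_simps)
    have off: "c i * n i * (c j * e j * u x) + c j * n j * (c i * e i * u x)
          - c i * c j * (?a (A 0) + ?a (A i \<inter> A j))
        = c i * e i * (c j * l j) + c j * e j * (c i * l i)" if "i < j" "j \<le> t" for i j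
    proof -
      have factor: "ci * ni * (cj * ej * v) + cj * nj * (ci * ei * v) - ci * cj * s
        = ci * cj * (ni * (ej * v) + nj * (ei * v) - s)" for ci cj ni nj ei ej v s :: real
        by (simp add: algebra_simps)
      have "n i * (e j * u x) + n j * (e i * u x) - (?a (A 0) + ?a (A i \<inter> A j))
        = e i * l j + e j * l i"
        using pair_identity[OF that x0, of u] unfolding n_def e_def l_def
        by (simp only: x0 if_True)
      then show ?thesis unfolding factor by (simp add: algebra_simps)
    qed
    have "(\<Sum>i=0..t. c i * n i) * (\<Sum>j=0..t. c j * e j * u x)
        - ((\<Sum>i=0..t. (c i)\<^sup>2 * ?a (A i))
          + (\<Sum>(i, j) | i < j \<and> j \<le> t. c i * c j * (?a (A 0) + ?a (A i \<inter> A j))))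
      = (\<Sum>i=0..t. c i * e i * (c i * l i))
        + (\<Sum>(i, j) | i < j \<and> j \<le> t. c i * e i * (c j * l j) + c j * e j * (c i * l i))"
      unfolding sum_mult_sum_minus_pairs diag
      by (intro arg_cong2[of _ _ _ _ "(+)"] sum.cong refl) (use off in \<open>simp only: case_prod_unfold mem_Collect_eq\<close>)
    also have "\<dots> = (\<Sum>i=0..t. c i * e i) * (\<Sum>j=0..t. c j * l j)"
      unfolding sum_mult_sum_pairs ..
    finally have main: "(\<Sum>i=0..t. c i * n i) * ((\<Sum>j=0..t. c j * e j) * u x)
        - ((\<Sum>i=0..t. (c i)\<^sup>2 * ?a (A i))
          + (\<Sum>(i, j) | i < j \<and> j \<le> t. c i * c j * (?a (A 0) + ?a (A i \<inter> A j))))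
      = (\<Sum>i=0..t. c i * e i) * (\<Sum>j=0..t. c j * l j)"
      unfolding sum_distrib_right .
    have tail: "C * (E * (v - w)) - R = E * L - C * E * w" if "C * (E * v) - R = E * L"
      for C E v w R L :: real
      using that by (simp add: algebra_simps)
    have "octopus_form t c A ?a
      = (\<Sum>i=0..t. c i * e i) * (\<Sum>j=0..t. c j * l j)
        - (\<Sum>i=0..t. c i * n i) * (\<Sum>j=0..t. c j * e j) * u 1"
      unfolding octopus_form_def leg using tail[OF main] unfolding n_def .
    also have "\<dots> = (\<Sum>i=0..t. c i * e i) * (\<Sum>i=0..t. c i * (l i - n i * u 1))"
    proof -
      have "(\<Sum>i=0..t. c i * (l i - n i * u 1))
        = (\<Sum>j=0..t. c j * l j) - (\<Sum>i=0..t. c i * n i) * u 1"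
        by (simp add: right_diff_distrib sum_subtractf sum_distrib_right mult.assoc)
      then show ?thesis by (simp add: right_diff_distrib)
    qed
    finally show ?thesis using False by (simp add: n_def e_def l_def)
  qed
qed

section \<open>The part without vectors fixed by a point stabilizer\<close>

text \<open>Here \<open>m B\<close> stands for the pairing with \<open>P\<^sub>B\<close> and \<open>f\<close> for that with the identity. By
  \<open>pair_card\<close> all multiples of \<open>f\<close> cancel. The remaining terms are non-negative multiples of values
  of \<open>m\<close>, except for those with \<open>A\<^sub>j \<union> {1}\<close>, which are assumed to vanish.\<close>

lemma octopus_form_nonneg:
  assumes nn: "\<And>B. B \<subseteq> A 0 \<Longrightarrow> m B \<ge> 0" and z: "\<And>j. j \<le> t \<Longrightarrow> m (A j \<union> {1}) = 0"
  shows "octopus_form t c A (\<lambda>B. real (card B) * (f - m B)) \<ge> 0"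
    (is "octopus_form t c A ?a \<ge> 0")
proof -
  define n where "n B = real (card B)" for B :: "nat set"
  have leg: "(\<Sum>j=0..t. c j * (?a (A j \<union> {1}) - ?a (A j)))
      = (\<Sum>j=0..t. c j * f) + (\<Sum>j=0..t. c j * (n (A j) * m (A j)))"
    unfolding sum.distrib[symmetric]
  proof (intro sum.cong refl)
    fix j assume "j \<in> {0..t}"
    then have "1 \<notin> A j" "finite (A j)" using A_le[of j] one_notin A_finite[of j] by auto
    then show "c j * (?a (A j \<union> {1}) - ?a (A j)) = c j * f + c j * (n (A j) * m (A j))"
      using z[of j] \<open>j \<in> {0..t}\<close> by (simp add: n_def algebra_simps)
  qed
  have off: "c i * n (A i) * (c j * f) + c j * n (A j) * (c i * f)
          - c i * c j * (?a (A 0) + ?a (A i \<inter> A j))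
        = c i * c j * (n (A 0) * m (A 0) + n (A i \<inter> A j) * m (A i \<inter> A j))"
    if "i < j" "j \<le> t" for i j
  proof -
    have "c i * n (A i) * (c j * f) + c j * n (A j) * (c i * f) = c i * c j * f * (n (A i) + n (A j))"
      by (simp add: algebra_simps)
    also have "n (A i) + n (A j) = n (A 0) + n (A i \<inter> A j)"
      unfolding n_def by (rule pair_card[OF that])
    finally show ?thesis by (simp add: n_def algebra_simps)
  qed
  have diag: "c i * n (A i) * (c i * f) - (c i)\<^sup>2 * ?a (A i) = (c i)\<^sup>2 * (n (A i) * m (A i))" for i
    by (simp add: n_def power2_eq_square algebra_simps)
  have "octopus_form t c A ?a
    = (\<Sum>i=0..t. c i * n (A i)) * (\<Sum>j=0..t. c j * (n (A j) * m (A j)))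
      + ((\<Sum>i=0..t. c i * n (A i)) * (\<Sum>j=0..t. c j * f)
        - ((\<Sum>i=0..t. (c i)\<^sup>2 * ?a (A i))
          + (\<Sum>(i, j) | i < j \<and> j \<le> t. c i * c j * (?a (A 0) + ?a (A i \<inter> A j)))))"
    unfolding octopus_form_def leg unfolding n_def by (simp only: distrib_left)
  also have "\<dots> = (\<Sum>i=0..t. c i * n (A i)) * (\<Sum>j=0..t. c j * (n (A j) * m (A j)))
      + ((\<Sum>i=0..t. (c i)\<^sup>2 * (n (A i) * m (A i)))
      + (\<Sum>(i, j) | i < j \<and> j \<le> t.
          c i * c j * (n (A 0) * m (A 0) + n (A i \<inter> A j) * m (A i \<inter> A j))))"
    unfolding sum_mult_sum_minus_pairs diag
    by (intro arg_cong2[of _ _ _ _ "(+)"] sum.cong refl) (use off in \<open>simp only: case_prod_unfold mem_Collect_eq\<close>)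
  also have "\<dots> \<ge> 0"
  proof -
    have nm: "n B * m B \<ge> 0" if "B \<subseteq> A 0" for B
      using nn[OF that] by (simp add: n_def)
    have pair: "c i * c j * (n (A 0) * m (A 0) + n (A i \<inter> A j) * m (A i \<inter> A j)) \<ge> 0"
      if "i < j" "j \<le> t" for i j
      by (intro mult_nonneg_nonneg add_nonneg_nonneg c_nonneg nm) (use that A_le[of j] in auto)
    have "(\<Sum>(i, j) | i < j \<and> j \<le> t.
          c i * c j * (n (A 0) * m (A 0) + n (A i \<inter> A j) * m (A i \<inter> A j))) \<ge> 0"
      by (intro sum_nonneg) (use pair in \<open>simp add: case_prod_unfold\<close>)
    moreover have "(\<Sum>i=0..t. (c i)\<^sup>2 * (n (A i) * m (A i))) \<ge> 0"
      using nm A_le by (intro sum_nonneg) auto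
    moreover have "(\<Sum>i=0..t. c i * n (A i)) \<ge> 0"
      using c_nonneg by (intro sum_nonneg) (auto simp: n_def)
    moreover have "(\<Sum>j=0..t. c j * (n (A j) * m (A j))) \<ge> 0"
      using nm A_le c_nonneg by (intro sum_nonneg) auto
    ultimately show ?thesis by (intro add_nonneg_nonneg mult_nonneg_nonneg)
  qed
  finally show ?thesis .
qed

lemma octopus_form_cong:
  assumes "\<And>B. B \<subseteq> A 0 \<union> {1} \<Longrightarrow> a B = b B"
  shows "octopus_form t c A a = octopus_form t c A b"
proof -
  have "a (A j) = b (A j)" "a (A j \<union> {1}) = b (A j \<union> {1})" "a (A i \<inter> A j) = b (A i \<inter> A j)"
    if "j \<le> t" for i j
    by (rule assms, use A_le[OF that] in blast)+
  moreover have "a (A 0) = b (A 0)" by (rule assms) blast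
  ultimately show ?thesis
    unfolding octopus_form_def
    by (intro arg_cong2[of _ _ _ _ "(-)"] arg_cong2[of _ _ _ _ "(+)"] arg_cong2[of _ _ _ _ "(*)"]
        sum.cong refl) auto
qed

section \<open>Eigenvalues in terms of matrix coefficients\<close>

text \<open>The function \<open>F\<close> is to be the matrix coefficient \<open>g \<mapsto> Re \<langle>g v, v\<rangle>\<close> of an eigenvector
  \<open>v\<close>. The last assumption is then the eigenvector equation, paired with all translates of \<open>v\<close>, and
  \<open>pos\<close> says that \<open>P\<^sub>B\<close> is positive semi-definite.\<close>

lemma eigenvalue_nonneg:
  fixes F :: "(nat \<Rightarrow> nat) \<Rightarrow> real" and k :: real
  assumes sub: "A 0 \<union> {1} \<subseteq> {1..n}"
    and pos: "\<And>B. B \<subseteq> A 0 \<Longrightarrow> 0 \<le> (\<Sum>\<pi> | \<pi> permutes B. F \<pi>)"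
    and id: "F id > 0"
    and eig: "\<And>h. h \<in> Sym n \<Longrightarrow>
      (\<Sum>g\<in>Sym n. octopus_form t c A (\<lambda>B. \<alpha> B g) * F (h \<circ> g)) = k * F h"
  shows "k \<ge> 0"
proof (rule ccontr)
  assume "\<not> k \<ge> 0"
  then have k: "k < 0" by simp
  define X where "X = A 0 \<union> {1}"
  have finX: "finite X" using finA0 by (simp add: X_def)
  have Xn: "X \<subseteq> {1..n}" using sub by (simp add: X_def)
  have AX: "A i \<subseteq> X" if "i \<le> t" for i using A_le[OF that] by (auto simp: X_def)
  have one: "1 \<in> X" by (simp add: X_def)
  \<comment> \<open>Translating a coset by \<open>\<pi>\<close> permutes the points \<open>x\<close>; this makes \<open>u z\<close> an element of the
    permutation representation with the same eigenvalue \<open>k\<close>.\<close>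
  define u where "u z x = (\<Sum>h | h permutes X \<and> h x = z. F h)" for z x
  define y where "y x = (if x = 1 then - (\<Sum>i=0..t. c i * real (card (A i)))
    else (\<Sum>i=0..t. c i * of_bool (x \<in> A i)))" for x
  define s where "s z = (\<Sum>i=0..t. c i * (sum (u z) (A i) - real (card (A i)) * u z 1))" for z
  have coset: "(\<Sum>h | h permutes X \<and> h x = z. F (h \<circ> \<pi>)) = u z (inv \<pi> x)"
    if \<pi>: "\<pi> permutes X" for \<pi> x z
    unfolding u_def
    by (rule sum.reindex_bij_witness[of _ "\<lambda>h. h \<circ> inv \<pi>" "\<lambda>h. h \<circ> \<pi>"])
       (auto simp: \<pi> permutes_inverses[OF \<pi>] permutes_compose permutes_inv comp_assoc
          permutes_inv_o[OF \<pi>])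
  have ku: "k * u z x = y x * s z" if x: "x \<in> X" for x z
  proof -
    let ?H = "{h. h permutes X \<and> h x = z}"
    let ?U = "\<lambda>g. \<Sum>h\<in>?H. F (h \<circ> g)"
    have "k * u z x = (\<Sum>h\<in>?H. \<Sum>g\<in>Sym n. octopus_form t c A (\<lambda>B. \<alpha> B g) * F (h \<circ> g))"
      unfolding u_def sum_distrib_left
      by (intro sum.cong refl eig[symmetric]) (use permutes_subset[OF _ Xn] in \<open>simp add: Sym_def\<close>)
    also have "\<dots> = (\<Sum>g\<in>Sym n. octopus_form t c A (\<lambda>B. \<alpha> B g) * ?U g)"
      by (subst sum.swap) (simp add: sum_distrib_left)
    also have "\<dots> = octopus_form t c A (\<lambda>B. \<Sum>g\<in>Sym n. \<alpha> B g * ?U g)"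
      by (rule octopus_form_sum)
    also have "\<dots> = octopus_form t c A (\<lambda>B. if x \<in> B then real (card B) * u z x - sum (u z) B else 0)"
    proof (rule octopus_form_cong)
      fix B assume "B \<subseteq> A 0 \<union> {1}"
      then have B: "B \<subseteq> X" by (simp add: X_def)
      then have finB: "finite B" using finX finite_subset by blast
      have "(\<Sum>\<pi> | \<pi> permutes B. ?U \<pi>) = (\<Sum>\<pi> | \<pi> permutes B. u z (inv \<pi> x))"
        by (intro sum.cong refl coset) (auto intro: permutes_subset[OF _ B])
      moreover have "?U id = u z x"
        using coset[OF permutes_id] by simp
      ultimately have "(\<Sum>g\<in>Sym n. \<alpha> B g * ?U g)
          = real (card B) * (u z x - (\<Sum>\<pi> | \<pi> permutes B. u z (inv \<pi> x)) / fact (card B))"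
        using sum_alpha[of B n ?U] B Xn by simp
      also have "\<dots> = (if x \<in> B then real (card B) * u z x - sum (u z) B else 0)"
      proof (cases "x \<in> B")
        case True
        then show ?thesis
          using sum_permutes_orbit[OF finB True, of "u z"] by (simp add: right_diff_distrib)
      next
        case False
        then have "inv \<pi> x = x" if "\<pi> permutes B" for \<pi>
          using permutes_not_in[OF permutes_inv[OF that]] by simp
        then have "(\<Sum>\<pi> | \<pi> permutes B. u z (inv \<pi> x)) = fact (card B) * u z x"
          by (simp add: card_permutations[OF refl finB])
        then show ?thesis using False by simp
      qed
      finally show "(\<Sum>g\<in>Sym n. \<alpha> B g * ?U g)
        = (if x \<in> B then real (card B) * u z x - sum (u z) B else 0)" .
    qed
    also have "\<dots> = y x * s z"
      unfolding y_def s_def by (rule octopus_form_rank_one) (use x in \<open>simp add: X_def\<close>)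
    finally show ?thesis .
  qed
  \<comment> \<open>The number \<open>r\<close> is the squared norm of \<open>y\<close>: pairing \<open>k u = s y\<close> with \<open>y\<close> gives \<open>k s = r s\<close>.\<close>
  define r where "r = (\<Sum>i=0..t. c i * (sum y (A i) - real (card (A i)) * y 1))"
  have cA: "(\<Sum>i=0..t. c i * real (card (A i))) \<ge> 0"
    using c_nonneg by (intro sum_nonneg) auto
  have "r \<ge> 0"
    unfolding r_def
  proof (intro sum_nonneg mult_nonneg_nonneg c_nonneg)
    fix i assume i: "i \<in> {0..t}"
    have "y x \<ge> 0" if "x \<in> A i" for x
    proof -
      have "x \<noteq> 1" using that A_le[of i] i one_notin by auto
      then show ?thesis using c_nonneg by (auto simp: y_def intro!: sum_nonneg)
    qed
    then have "sum y (A i) \<ge> 0" by (rule sum_nonneg)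
    moreover have "real (card (A i)) * y 1 \<le> 0"
      using cA by (simp add: y_def mult_nonneg_nonpos)
    ultimately show "0 \<le> sum y (A i) - real (card (A i)) * y 1" by linarith
  qed
  have u0: "u z x = 0" if x: "x \<in> X" for z x
  proof -
    have leg: "k * (sum (u z) (A i) - real (card (A i)) * u z 1)
        = (sum y (A i) - real (card (A i)) * y 1) * s z" if "i \<le> t" for i
    proof -
      have "k * sum (u z) (A i) = sum y (A i) * s z"
        unfolding sum_distrib_left sum_distrib_right
        by (intro sum.cong refl ku) (use AX[OF that] in blast)
      then show ?thesis
        using ku[OF one, of z] by (simp add: algebra_simps)
    qed
    have "k * s z = (\<Sum>i=0..t. c i * (k * (sum (u z) (A i) - real (card (A i)) * u z 1)))"
      unfolding s_def sum_distrib_left by (simp only: mult.left_commute)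
    also have "\<dots> = (\<Sum>i=0..t. c i * ((sum y (A i) - real (card (A i)) * y 1) * s z))"
      by (intro sum.cong refl arg_cong2[of _ _ _ _ "(*)"] leg) simp
    also have "\<dots> = r * s z"
      unfolding r_def sum_distrib_right by (simp only: mult.assoc)
    finally have "k * s z = r * s z" .
    then have "s z = 0" using k \<open>r \<ge> 0\<close> by auto
    then show ?thesis using ku[OF x, of z] k by simp
  qed
  define m where "m B = (\<Sum>\<pi> | \<pi> permutes B. F \<pi>) / fact (card B)" for B
  \<comment> \<open>\<open>Sym(X)\<close> is the disjoint union of the cosets \<open>h 1 = z\<close>, and \<open>Sym(X - {a})\<close> is the coset
    \<open>h a = a\<close>.\<close>
  have "m (A j \<union> {1}) = 0" if j: "j \<le> t" for j
  proof (cases "j = 0")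
    case True
    have "h 1 \<in> X" if "h permutes X" for h
      using permutes_in_image[OF that, of 1] one by simp
    then have "(\<lambda>h. h 1) ` {h. h permutes X} \<subseteq> X" by blast
    from sum.group[OF finite_permutations[OF finX] finX this, of F]
    have "(\<Sum>h | h permutes X. F h) = (\<Sum>z\<in>X. u z 1)"
      by (simp add: u_def)
    also have "\<dots> = 0" using u0[OF one] by simp
    finally show ?thesis using True by (simp add: m_def X_def)
  next
    case False
    with j have "j \<in> {1..t}" by auto
    then obtain a where a: "a \<in> A 0" "A j = A 0 - {a}" by (rule A_remove)
    have eq: "A j \<union> {1} = X - {a}" using a one_notin by (auto simp: X_def)
    have "{h. h permutes X - {a}} = {h. h permutes X \<and> h a = a}"
      by (auto simp: permutes_def)
    then have "(\<Sum>h | h permutes X - {a}. F h) = u a a" by (simp add: u_def)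
    also have "\<dots> = 0" using a by (intro u0) (simp add: X_def)
    finally show ?thesis unfolding m_def eq by simp
  qed
  moreover have "m B \<ge> 0" if "B \<subseteq> A 0" for B
    using pos[OF that] by (simp add: m_def)
  ultimately have "0 \<le> octopus_form t c A (\<lambda>B. real (card B) * (F id - m B))"
    by (intro octopus_form_nonneg)
  also have "\<dots> = octopus_form t c A (\<lambda>B. \<Sum>g\<in>Sym n. \<alpha> B g * F g)"
  proof (rule octopus_form_cong)
    fix B assume "B \<subseteq> A 0 \<union> {1}"
    then have "B \<subseteq> {1..n}" using sub by blast
    then show "real (card B) * (F id - m B) = (\<Sum>g\<in>Sym n. \<alpha> B g * F g)"
      unfolding m_def by (rule sum_alpha[symmetric])
  qed
  also have "\<dots> = k * F id"
    using eig[of id] by (simp add: octopus_form_sum Sym_def)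
  finally show False using k id by (simp add: zero_le_mult_iff)
qed

end

section \<open>Representations with an invariant inner product\<close>

lemma act_mult_vec:
  assumes "\<And>g. g \<in> Sym n \<Longrightarrow> \<rho> g \<in> carrier_mat d d" and v: "v \<in> carrier_vec d"
  shows "act n d \<rho> f *\<^sub>v v = vec d (\<lambda>i. \<Sum>g\<in>Sym n. complex_of_real (f g) * (\<rho> g *\<^sub>v v) $ i)"
proof (rule eq_vecI)
  fix i assume "i < dim_vec (vec d (\<lambda>i. \<Sum>g\<in>Sym n. complex_of_real (f g) * (\<rho> g *\<^sub>v v) $ i))"
  then have i: "i < d" by simp
  have g: "(\<rho> g *\<^sub>v v) $ i = (\<Sum>j<d. \<rho> g $$ (i, j) * v $ j)" if "g \<in> Sym n" for g
    using assms(1)[OF that] v i by (auto simp: scalar_prod_def atLeast0LessThan intro!: sum.cong)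
  have "(act n d \<rho> f *\<^sub>v v) $ i
      = (\<Sum>j<d. (\<Sum>g\<in>Sym n. complex_of_real (f g) * \<rho> g $$ (i, j)) * v $ j)"
    using v i by (auto simp: act_def scalar_prod_def atLeast0LessThan intro!: sum.cong)
  also have "\<dots> = (\<Sum>g\<in>Sym n. complex_of_real (f g) * (\<Sum>j<d. \<rho> g $$ (i, j) * v $ j))"
    unfolding sum_distrib_right by (subst sum.swap) (simp add: sum_distrib_left mult.assoc)
  also have "\<dots> = (\<Sum>g\<in>Sym n. complex_of_real (f g) * (\<rho> g *\<^sub>v v) $ i)"
    using g by simp
  finally show "(act n d \<rho> f *\<^sub>v v) $ i
    = vec d (\<lambda>i. \<Sum>g\<in>Sym n. complex_of_real (f g) * (\<rho> g *\<^sub>v v) $ i) $ i"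
    using i by simp
qed (simp add: act_def)

text \<open>The conjunct on conjugate symmetry loops as a rewrite rule, so the conjuncts are stated
  separately instead of unfolding the definition.\<close>

lemma
  assumes "inner_product d ip" and "v \<in> carrier_vec d" "w \<in> carrier_vec d"
  shows inner_product_add:
      "u \<in> carrier_vec d \<Longrightarrow> ip (u + v) w = ip u w + ip v w"
    and inner_product_smult: "ip (a \<cdot>\<^sub>v v) w = a * ip v w"
    and inner_product_cnj: "ip w v = cnj (ip v w)"
    and inner_product_pos: "v \<noteq> 0\<^sub>v d \<Longrightarrow> Re (ip v v) > 0"
  using assms unfolding inner_product_def by blast+

lemma inner_product_sum:
  assumes ip: "inner_product d ip" and "finite S" and w: "w \<in> carrier_vec d"
    and f: "\<And>s. s \<in> S \<Longrightarrow> f s \<in> carrier_vec d"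
  shows "ip (vec d (\<lambda>i. \<Sum>s\<in>S. a s * f s $ i)) w = (\<Sum>s\<in>S. a s * ip (f s) w)"
  using \<open>finite S\<close> f
proof (induction S rule: finite_induct)
  case empty
  have "vec d (\<lambda>i. 0) = 0 \<cdot>\<^sub>v w" using w by (intro eq_vecI) auto
  then show ?case using inner_product_smult[OF ip w w, of 0] by simp
next
  case (insert x S)
  have fx: "f x \<in> carrier_vec d" using insert.prems by simp
  have "vec d (\<lambda>i. \<Sum>s\<in>insert x S. a s * f s $ i)
    = a x \<cdot>\<^sub>v f x + vec d (\<lambda>i. \<Sum>s\<in>S. a s * f s $ i)"
    using fx insert.hyps by (intro eq_vecI) auto
  moreover have "ip (a x \<cdot>\<^sub>v f x + vec d (\<lambda>i. \<Sum>s\<in>S. a s * f s $ i)) w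
    = a x * ip (f x) w + ip (vec d (\<lambda>i. \<Sum>s\<in>S. a s * f s $ i)) w"
    using fx w by (simp add: inner_product_add[OF ip] inner_product_smult[OF ip])
  ultimately show ?case using insert by simp
qed

locale unitary_rep =
  fixes n d :: nat and \<rho> :: "(nat \<Rightarrow> nat) \<Rightarrow> complex mat"
    and ip :: "complex vec \<Rightarrow> complex vec \<Rightarrow> complex"
  assumes rep: "sym_rep n d \<rho>" and ip: "inner_product d ip" and inv: "invariant_ip n d \<rho> ip"
begin

lemma finite_Sym: "finite (Sym n)"
  unfolding Sym_def by (rule finite_permutations) simp

lemma rho_carrier [simp]: "g \<in> Sym n \<Longrightarrow> \<rho> g \<in> carrier_mat d d"
  using rep by (simp add: sym_rep_def)

lemma rho_vec [simp]: "g \<in> Sym n \<Longrightarrow> v \<in> carrier_vec d \<Longrightarrow> \<rho> g *\<^sub>v v \<in> carrier_vec d"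
  by (rule mult_mat_vec_carrier[OF rho_carrier])

lemma Sym_inv: "g \<in> Sym n \<Longrightarrow> inv g \<in> Sym n"
  by (simp add: Sym_def permutes_inv)

lemma Sym_comp: "g \<in> Sym n \<Longrightarrow> h \<in> Sym n \<Longrightarrow> g \<circ> h \<in> Sym n"
  by (simp add: Sym_def permutes_compose)

lemma rho_comp:
  "g \<in> Sym n \<Longrightarrow> h \<in> Sym n \<Longrightarrow> v \<in> carrier_vec d \<Longrightarrow> \<rho> (g \<circ> h) *\<^sub>v v = \<rho> g *\<^sub>v (\<rho> h *\<^sub>v v)"
  using rep assoc_mult_mat_vec[of "\<rho> g" d d "\<rho> h" d v] by (simp add: sym_rep_def)

lemma ip_rho_comp:
  assumes g: "g \<in> Sym n" and h: "h \<in> Sym n" and v: "v \<in> carrier_vec d" and w: "w \<in> carrier_vec d"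
  shows "ip (\<rho> (h \<circ> g) *\<^sub>v v) w = ip (\<rho> g *\<^sub>v v) (\<rho> (inv h) *\<^sub>v w)"
proof -
  have "h \<circ> inv h = id" using h by (simp add: Sym_def permutes_inv_o)
  then have "w = \<rho> h *\<^sub>v (\<rho> (inv h) *\<^sub>v w)"
    using rho_comp[OF h Sym_inv[OF h] w] rep w by (simp add: sym_rep_def)
  then have "ip (\<rho> (h \<circ> g) *\<^sub>v v) w = ip (\<rho> h *\<^sub>v (\<rho> g *\<^sub>v v)) (\<rho> h *\<^sub>v (\<rho> (inv h) *\<^sub>v w))"
    using rho_comp[OF h g v] by simp
  also have "\<dots> = ip (\<rho> g *\<^sub>v v) (\<rho> (inv h) *\<^sub>v w)"
    using inv rho_vec[OF g v] rho_vec[OF Sym_inv[OF h] w] h by (simp add: invariant_ip_def)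
  finally show ?thesis .
qed

lemma ip_act:
  assumes "v \<in> carrier_vec d" "w \<in> carrier_vec d"
  shows "ip (act n d \<rho> f *\<^sub>v v) w = (\<Sum>g\<in>Sym n. complex_of_real (f g) * ip (\<rho> g *\<^sub>v v) w)"
  using assms act_mult_vec[of n \<rho> d v f] inner_product_sum[OF ip finite_Sym, of w "\<lambda>g. \<rho> g *\<^sub>v v"]
  by simp

lemma act_carrier [simp]: "v \<in> carrier_vec d \<Longrightarrow> act n d \<rho> f *\<^sub>v v \<in> carrier_vec d"
  by (rule mult_mat_vec_carrier[of _ d d]) (simp_all add: act_def)

lemma act_self_adjoint:
  assumes sym: "\<And>g. g \<in> Sym n \<Longrightarrow> f (inv g) = f g"
    and v: "v \<in> carrier_vec d" and w: "w \<in> carrier_vec d"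
  shows "ip (act n d \<rho> f *\<^sub>v v) w = ip v (act n d \<rho> f *\<^sub>v w)"
proof -
  have id: "\<rho> id *\<^sub>v v = v" "id \<in> Sym n" using rep v by (simp_all add: sym_rep_def Sym_def permutes_id)
  have "ip v (act n d \<rho> f *\<^sub>v w) = cnj (ip (act n d \<rho> f *\<^sub>v w) v)"
    using v w by (intro inner_product_cnj[OF ip]) auto
  also have "\<dots> = (\<Sum>g\<in>Sym n. complex_of_real (f g) * cnj (ip (\<rho> g *\<^sub>v w) v))"
    using v w by (simp add: ip_act)
  also have "\<dots> = (\<Sum>g\<in>Sym n. complex_of_real (f g) * ip v (\<rho> g *\<^sub>v w))"
    using v w by (intro sum.cong refl) (simp add: inner_product_cnj[OF ip, of "\<rho> _ *\<^sub>v w" v])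
  also have "\<dots> = (\<Sum>g\<in>Sym n. complex_of_real (f (inv g)) * ip v (\<rho> (inv g) *\<^sub>v w))"
    unfolding Sym_def by (rule sum_permutations_inverse)
  also have "\<dots> = (\<Sum>g\<in>Sym n. complex_of_real (f g) * ip (\<rho> g *\<^sub>v v) w)"
  proof (intro sum.cong refl)
    fix g assume g: "g \<in> Sym n"
    show "complex_of_real (f (inv g)) * ip v (\<rho> (inv g) *\<^sub>v w)
      = complex_of_real (f g) * ip (\<rho> g *\<^sub>v v) w"
      using ip_rho_comp[OF id(2) g v w] sym[OF g] id(1) by simp
  qed
  finally show ?thesis using v w by (simp add: ip_act)
qed

text \<open>With \<open>p = \<Sum>\<^sub>\<pi> \<pi> v\<close>, where \<open>\<pi>\<close> runs through \<open>Sym(B)\<close>, the sum is the real part of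
  \<open>\<langle>p, v\<rangle>\<close>. As \<open>p\<close> is fixed by \<open>Sym(B)\<close>, this is \<open>\<langle>p, p\<rangle>\<close> divided by the order of \<open>Sym(B)\<close>.\<close>

lemma sum_subgroup_nonneg:
  assumes B: "B \<subseteq> {1..n}" and v: "v \<in> carrier_vec d"
  shows "0 \<le> (\<Sum>\<pi> | \<pi> permutes B. Re (ip (\<rho> \<pi> *\<^sub>v v) v))"
proof -
  let ?G = "{\<pi>. \<pi> permutes B}"
  have finB: "finite B" using B finite_subset by blast
  have G: "\<pi> \<in> Sym n" if "\<pi> \<in> ?G" for \<pi>
    using permutes_subset[OF _ B] that by (simp add: Sym_def)
  define p where "p = vec d (\<lambda>i. \<Sum>\<pi>\<in>?G. 1 * (\<rho> \<pi> *\<^sub>v v) $ i)"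
  have p: "p \<in> carrier_vec d" by (simp add: p_def)
  have ipp: "ip p w = (\<Sum>\<pi>\<in>?G. ip (\<rho> \<pi> *\<^sub>v v) w)" if "w \<in> carrier_vec d" for w
    unfolding p_def using inner_product_sum[OF ip finite_permutations[OF finB] that, of "\<lambda>\<pi>. \<rho> \<pi> *\<^sub>v v" "\<lambda>_. 1"]
      G v by simp
  have fixed: "ip p (\<rho> \<pi> *\<^sub>v v) = ip p v" if \<pi>: "\<pi> \<in> ?G" for \<pi>
  proof -
    have inv\<pi>: "inv \<pi> permutes B" using \<pi> by (simp add: permutes_inv)
    have "ip p v = (\<Sum>\<sigma>\<in>?G. ip (\<rho> (inv \<pi> \<circ> \<sigma>) *\<^sub>v v) v)"
      unfolding ipp[OF v] by (rule setum_permutations_compose_left[OF inv\<pi>])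
    also have "\<dots> = (\<Sum>\<sigma>\<in>?G. ip (\<rho> \<sigma> *\<^sub>v v) (\<rho> \<pi> *\<^sub>v v))"
    proof (intro sum.cong refl)
      fix \<sigma> assume "\<sigma> \<in> ?G"
      moreover have "inv (inv \<pi>) = \<pi>" using \<pi> by (simp add: permutes_inv_inv)
      ultimately show "ip (\<rho> (inv \<pi> \<circ> \<sigma>) *\<^sub>v v) v = ip (\<rho> \<sigma> *\<^sub>v v) (\<rho> \<pi> *\<^sub>v v)"
        using ip_rho_comp[of \<sigma> "inv \<pi>" v v] G inv\<pi> v by simp
    qed
    also have "\<dots> = ip p (\<rho> \<pi> *\<^sub>v v)" using ipp[of "\<rho> \<pi> *\<^sub>v v"] G[OF \<pi>] v by simp
    finally show ?thesis ..
  qed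
  have "ip p p = (\<Sum>\<pi>\<in>?G. ip (\<rho> \<pi> *\<^sub>v v) p)" by (rule ipp[OF p])
  also have "\<dots> = (\<Sum>\<pi>\<in>?G. cnj (ip p v))"
  proof (intro sum.cong refl)
    fix \<pi> assume \<pi>: "\<pi> \<in> ?G"
    show "ip (\<rho> \<pi> *\<^sub>v v) p = cnj (ip p v)"
      using inner_product_cnj[OF ip p rho_vec[OF G[OF \<pi>] v]] fixed[OF \<pi>] by simp
  qed
  finally have "Re (ip p p) = fact (card B) * Re (ip p v)"
    by (simp add: card_permutations[OF refl finB])
  moreover have "Re (ip p p) \<ge> 0"
  proof (cases "p = 0\<^sub>v d")
    case True
    then have "0 \<cdot>\<^sub>v p = p" by (intro eq_vecI) auto
    then show ?thesis using inner_product_smult[OF ip p p, of 0] by simp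
  next
    case False
    then show ?thesis using inner_product_pos[OF ip p p] by simp
  qed
  ultimately have "Re (ip p v) \<ge> 0"
    using fact_gt_zero[of "card B", where ?'a = real] by (metis not_le zero_le_mult_iff)
  then show ?thesis using ipp[OF v] by simp
qed

text \<open>Positivity of the eigenvalues has to be shown only for real \<open>k\<close> and in terms of the matrix
  coefficient \<open>F\<close> of an eigenvector: its first property says that the vector is not zero, its second
  one is \<open>sum_subgroup_nonneg\<close>.\<close>

lemma pos_semidefI:
  assumes sym: "\<And>g. g \<in> Sym n \<Longrightarrow> f (inv g) = f g"
    and eig: "\<And>F k. F id > 0 \<Longrightarrow> (\<And>B. B \<subseteq> {1..n} \<Longrightarrow> 0 \<le> (\<Sum>\<pi> | \<pi> permutes B. F \<pi>)) \<Longrightarrow>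
      (\<And>h. h \<in> Sym n \<Longrightarrow> (\<Sum>g\<in>Sym n. f g * F (h \<circ> g)) = k * F h) \<Longrightarrow> k \<ge> (0::real)"
  shows "pos_semidef d ip (act n d \<rho> f)"
  unfolding pos_semidef_def
proof (intro conjI ballI allI impI)
  fix v w :: "complex vec" assume "v \<in> carrier_vec d" "w \<in> carrier_vec d"
  then show "ip (act n d \<rho> f *\<^sub>v v) w = ip v (act n d \<rho> f *\<^sub>v w)"
    using act_self_adjoint[of f, OF sym] by blast
next
  fix k :: complex assume "eigenvalue (act n d \<rho> f) k"
  then obtain v where v: "v \<in> carrier_vec d" and v0: "v \<noteq> 0\<^sub>v d"
    and ev: "act n d \<rho> f *\<^sub>v v = k \<cdot>\<^sub>v v"
    by (auto simp: eigenvalue_def eigenvector_def act_def)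
  have vv: "Re (ip v v) > 0" by (rule inner_product_pos[OF ip v v v0])
  have scale: "ip (k \<cdot>\<^sub>v v) w = k * ip v w" if "w \<in> carrier_vec d" for w
    by (rule inner_product_smult[OF ip v that])
  have "k * ip v v = ip v (k \<cdot>\<^sub>v v)"
    using act_self_adjoint[of f, OF sym v v] by (simp add: ev scale[OF v])
  also have "\<dots> = cnj (ip (k \<cdot>\<^sub>v v) v)" using v by (intro inner_product_cnj[OF ip]) auto
  also have "\<dots> = cnj k * cnj (ip v v)" by (simp add: scale[OF v])
  also have "cnj (ip v v) = ip v v" using inner_product_cnj[OF ip v v] by simp
  finally have "cnj k = k" using vv by auto
  then show real: "k \<in> \<real>" by (simp add: Reals_cnj_iff)
  define F where "F g = Re (ip (\<rho> g *\<^sub>v v) v)" for g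
  show "Re k \<ge> 0"
  proof (rule eig[of F])
    show "F id > 0" using vv rep v by (simp add: F_def sym_rep_def)
    show "0 \<le> (\<Sum>\<pi> | \<pi> permutes B. F \<pi>)" if "B \<subseteq> {1..n}" for B
      unfolding F_def by (rule sum_subgroup_nonneg[OF that v])
    fix h assume h: "h \<in> Sym n"
    have w: "\<rho> (inv h) *\<^sub>v v \<in> carrier_vec d" using Sym_inv[OF h] v by simp
    have "(\<Sum>g\<in>Sym n. f g * F (h \<circ> g))
      = Re (\<Sum>g\<in>Sym n. complex_of_real (f g) * ip (\<rho> g *\<^sub>v v) (\<rho> (inv h) *\<^sub>v v))"
      unfolding F_def Re_sum by (intro sum.cong refl) (simp add: ip_rho_comp h v)
    also have "\<dots> = Re (k * ip v (\<rho> (inv h) *\<^sub>v v))"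
      unfolding ip_act[OF v w, symmetric] ev scale[OF w] ..
    also have "ip v (\<rho> (inv h) *\<^sub>v v) = ip (\<rho> h *\<^sub>v v) v"
    proof -
      have "id \<in> Sym n" by (simp add: Sym_def permutes_id)
      from ip_rho_comp[OF this h v v] show ?thesis using rep v by (simp add: sym_rep_def)
    qed
    also have "Re (k * ip (\<rho> h *\<^sub>v v) v) = Re k * F h"
      using real by (auto simp: F_def elim!: Reals_cases)
    finally show "(\<Sum>g\<in>Sym n. f g * F (h \<circ> g)) = Re k * F h" .
  qed
qed

end

section \<open>The generalized octopus inequality\<close>

theorem theorem1p9:
  fixes n t :: nat and A :: "nat \<Rightarrow> nat set" and c :: "nat \<Rightarrow> real"
  assumes "A 0 \<subseteq> {2..n}"
    and "inj_on A {1..t}"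
    and "\<And>i. i \<in> {1..t} \<Longrightarrow> A i \<subseteq> A 0 \<and> card (A 0 - A i) = 1"
    and "\<And>i. i \<in> {0..t} \<Longrightarrow> c i \<ge> 0"
  shows "(\<lambda>\<sigma>. (\<Sum>i=0..t. c i * real (card (A i))) *
               (\<Sum>j=0..t. c j * (\<alpha> (A j \<union> {1}) \<sigma> - \<alpha> (A j) \<sigma>)))
         \<succeq>\<^bsub>n\<^esub>
         (\<lambda>\<sigma>. (\<Sum>i=0..t. (c i)\<^sup>2 * \<alpha> (A i) \<sigma>) +
               (\<Sum>(i, j) | i < j \<and> j \<le> t. c i * c j * (\<alpha> (A 0) \<sigma> + \<alpha> (A i \<inter> A j) \<sigma>)))"
proof -
  interpret octopus t A c
  proof
    show "finite (A 0)" using assms(1) finite_subset by blast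
    show "1 \<notin> A 0" using assms(1) by auto
  qed (fact assms)+
  have eig: "k \<ge> 0"
    if id: "F id > 0" and pos: "\<And>B. B \<subseteq> {1..n} \<Longrightarrow> 0 \<le> (\<Sum>\<pi> | \<pi> permutes B. F \<pi>)"
      and ev: "\<And>h. h \<in> Sym n \<Longrightarrow>
        (\<Sum>g\<in>Sym n. octopus_form t c A (\<lambda>B. \<alpha> B g) * F (h \<circ> g)) = k * F h"
    for F and k :: real
  proof (cases "n = 0")
    \<comment> \<open>For \<open>n = 0\<close> the point \<open>1\<close> is missing from \<open>{1..n}\<close>, but then \<open>A 0\<close> is empty and both sides
      are zero on \<open>Sym 0\<close>.\<close>
    case True
    then have A0: "A 0 = {}" using assms(1) by auto
    have t0: "t = 0"
    proof (rule ccontr)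
      assume "t \<noteq> 0"
      then have "card (A 0 - A 1) = 1" using A_sub[of 1] by simp
      then show False using A0 by simp
    qed
    have no_pairs: "{(i, j). i < j \<and> j \<le> (0::nat)} = {}" by auto
    have "octopus_form t c A a = - ((c 0)\<^sup>2 * a {})" for a
      unfolding octopus_form_def t0 no_pairs by (simp add: A0)
    then have "k * F id = 0"
      using ev[of id] by (simp add: Sym_def permutes_id \<alpha>_def)
    then show ?thesis using id by simp
  next
    case False
    have sub: "A 0 \<union> {1} \<subseteq> {1..n}" using assms(1) False by auto
    show ?thesis
    proof (rule eigenvalue_nonneg[OF sub _ id ev])
      show "0 \<le> (\<Sum>\<pi> | \<pi> permutes B. F \<pi>)" if "B \<subseteq> A 0" for B
        using pos[of B] sub that by auto
    qed
  qed
  have sym: "octopus_form t c A (\<lambda>B. \<alpha> B (inv g)) = octopus_form t c A (\<lambda>B. \<alpha> B g)"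
    if "g \<in> Sym n" for g
    using that by (intro octopus_form_cong alpha_inv) (auto simp: Sym_def permutes_bij)
  show ?thesis
    unfolding op_ge_def octopus_form_def[of t c A "\<lambda>B. \<alpha> B _", symmetric]
  proof (intro allI impI, elim conjE)
    fix d \<rho> ip
    assume "sym_rep n d \<rho>" "inner_product d ip" "invariant_ip n d \<rho> ip"
    then interpret unitary_rep n d \<rho> ip by unfold_locales
    show "pos_semidef d ip (act n d \<rho> (\<lambda>\<sigma>. octopus_form t c A (\<lambda>B. \<alpha> B \<sigma>)))"
      by (rule pos_semidefI) (fact sym, fact eig)
  qed
qed

end
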